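(* Let $G$ be a finite group. If $\gamma(G)=1$, then the intersection complex $K(G)$ is contractible.
   Context: For a group $G$, $V(G)$ denotes the set of all proper non-trivial subgroups of $G$. The intersection graph $\Gamma(G)$ is the simple undirected graph with vertex set $V(G)$ in which two distinct vertices $H,K$ are adjacent if and only if $H\cap K\neq 1$. A dominating set of a graph is a subset $D$ of its vertex set such that every vertex not in $D$ is adjacent to some vertex in $D$. The domination number $\gamma(G)$ is the smallest cardinality of a dominating set of $\Gamma(G)$; by convention $\gamma(G)=\aleph_0$ when $V(G)$ is empty. The intersection complex $K(G)$ is the abstract simplicial complex with vertex set $V(G)$ whose (non-empty) faces are the sets of proper subgroups $\{H_1,\dots,H_m\}$ of $G$ with $H_1\cap\dots\cap H_m\neq 1$. Contractibility refers to the geometric realization. *)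

theory Defs
  imports
    "HOL-Analysis.Analysis"
    "HOL-Algebra.Group"
    "Graph_Theory.Pair_Digraph"
begin

section \<open>Domination in graphs\<close>

definition dominating_set :: "'v pair_pre_digraph \<Rightarrow> 'v set \<Rightarrow> bool" where
  "dominating_set \<Gamma> D \<longleftrightarrow>
     D \<subseteq> pverts \<Gamma> \<and> (\<forall>v \<in> pverts \<Gamma> - D. \<exists>d \<in> D. (v, d) \<in> parcs \<Gamma>)"

text \<open>
  On the graph without vertices the domination number is \<open>\<aleph>\<^sub>0\<close> by convention
  (and not 0, the cardinality of the empty dominating set).  The value \<open>\<infinity>\<close> of \<open>enat\<close> stands
  for \<open>\<aleph>\<^sub>0\<close>; larger infinite cardinals are not distinguished from it.
\<close>

definition domination_number :: "'v pair_pre_digraph \<Rightarrow> enat" where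
  "domination_number \<Gamma> =
     (if pverts \<Gamma> = {} then \<infinity>
      else (INF D \<in> {D. dominating_set \<Gamma> D}. if finite D then enat (card D) else \<infinity>))"

section \<open>Geometric realization of an abstract simplicial complex\<close>

text \<open>
  A complex is given by its set of faces, which are non-empty finite sets.  Points are given by
  their barycentric coordinates, extended by 0 to the whole type of vertices.
\<close>

definition abstract_simplicial_complex :: "'v set set \<Rightarrow> bool" where
  "abstract_simplicial_complex K \<longleftrightarrow>
     (\<forall>\<sigma> \<in> K. finite \<sigma> \<and> \<sigma> \<noteq> {}) \<and> (\<forall>\<sigma> \<in> K. \<forall>\<tau>. \<tau> \<subseteq> \<sigma> \<and> \<tau> \<noteq> {} \<longrightarrow> \<tau> \<in> K)"

definition closed_simplex :: "'v set \<Rightarrow> ('v \<Rightarrow> real) set" where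
  "closed_simplex \<sigma> =
     {x. (\<forall>v \<in> \<sigma>. 0 \<le> x v) \<and> (\<forall>v. v \<notin> \<sigma> \<longrightarrow> x v = 0) \<and> (\<Sum>v \<in> \<sigma>. x v) = 1}"

definition polyhedron_of :: "'v set set \<Rightarrow> ('v \<Rightarrow> real) set" where
  "polyhedron_of K = (\<Union>\<sigma> \<in> K. closed_simplex \<sigma>)"

text \<open>
  The weak topology with respect to the closed simplices.  For finite \<open>\<sigma>\<close>, the product topology
  of \<open>'v \<Rightarrow> real\<close> induces the Euclidean topology on \<open>closed_simplex \<sigma>\<close>.
\<close>

definition geometric_realization :: "'v set set \<Rightarrow> ('v \<Rightarrow> real) topology" where
  "geometric_realization K =
     topology (\<lambda>U. U \<subseteq> polyhedron_of K \<and>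
       (\<forall>\<sigma> \<in> K. openin (top_of_set (closed_simplex \<sigma>)) (U \<inter> closed_simplex \<sigma>)))"

lemma openin_geometric_realization:
  "openin (geometric_realization K) U \<longleftrightarrow> U \<subseteq> polyhedron_of K \<and>
     (\<forall>\<sigma> \<in> K. openin (top_of_set (closed_simplex \<sigma>)) (U \<inter> closed_simplex \<sigma>))"
proof -
  define P where "P = (\<lambda>U. U \<subseteq> polyhedron_of K \<and>
     (\<forall>\<sigma> \<in> K. openin (top_of_set (closed_simplex \<sigma>)) (U \<inter> closed_simplex \<sigma>)))"
  have "istopology P"
    unfolding istopology_def
  proof (intro conjI allI impI)
    fix S T assume S: "P S" and T: "P T"
    have "openin (top_of_set (closed_simplex \<sigma>)) ((S \<inter> T) \<inter> closed_simplex \<sigma>)"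
      if "\<sigma> \<in> K" for \<sigma>
    proof -
      have "(S \<inter> T) \<inter> closed_simplex \<sigma> = (S \<inter> closed_simplex \<sigma>) \<inter> (T \<inter> closed_simplex \<sigma>)"
        by blast
      then show ?thesis
        using S T that unfolding P_def by (simp only: openin_Int)
    qed
    with S show "P (S \<inter> T)"
      unfolding P_def by blast
  next
    fix \<U> assume U: "\<forall>S \<in> \<U>. P S"
    have "openin (top_of_set (closed_simplex \<sigma>)) (\<Union>\<U> \<inter> closed_simplex \<sigma>)"
      if "\<sigma> \<in> K" for \<sigma>
    proof -
      have "openin (top_of_set (closed_simplex \<sigma>)) (\<Union>S \<in> \<U>. S \<inter> closed_simplex \<sigma>)"
        using U that unfolding P_def by (intro openin_Union) blast
      moreover have "(\<Union>S \<in> \<U>. S \<inter> closed_simplex \<sigma>) = \<Union>\<U> \<inter> closed_simplex \<sigma>"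
        by blast
      ultimately show ?thesis
        by (rule back_subst[where P = "openin _"])
    qed
    with U show "P (\<Union>\<U>)"
      unfolding P_def by blast
  qed
  moreover have "geometric_realization K = topology P"
    unfolding geometric_realization_def P_def ..
  ultimately show ?thesis
    by (simp add: topology_inverse' P_def)
qed

lemma topspace_geometric_realization [simp]:
  "topspace (geometric_realization K) = polyhedron_of K"
proof -
  have "openin (geometric_realization K) (polyhedron_of K)"
    unfolding openin_geometric_realization
  proof (intro conjI ballI subset_refl)
    fix \<sigma> assume "\<sigma> \<in> K"
    then have "polyhedron_of K \<inter> closed_simplex \<sigma> = closed_simplex \<sigma>"
      unfolding polyhedron_of_def by blast
    then show "openin (top_of_set (closed_simplex \<sigma>)) (polyhedron_of K \<inter> closed_simplex \<sigma>)"
      by simp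
  qed
  then have "polyhedron_of K \<subseteq> topspace (geometric_realization K)"
    by (rule openin_subset)
  moreover have "topspace (geometric_realization K) \<subseteq> polyhedron_of K"
    using openin_topspace[of "geometric_realization K"]
    unfolding openin_geometric_realization by (rule conjunct1)
  ultimately show ?thesis
    by (rule equalityI[rotated])
qed

section \<open>Intersection graph and intersection complex of a group\<close>

definition proper_nontrivial_subgroups :: "('a, 'b) monoid_scheme \<Rightarrow> 'a set set" where
  "proper_nontrivial_subgroups G =
     {H. subgroup H G \<and> H \<noteq> {\<one>\<^bsub>G\<^esub>} \<and> H \<noteq> carrier G}"

definition intersection_graph :: "('a, 'b) monoid_scheme \<Rightarrow> 'a set pair_pre_digraph" where
  "intersection_graph G =
     \<lparr> pverts = proper_nontrivial_subgroups G,
       parcs = {(H, K). H \<in> proper_nontrivial_subgroups G \<and> K \<in> proper_nontrivial_subgroups G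
                  \<and> H \<noteq> K \<and> H \<inter> K \<noteq> {\<one>\<^bsub>G\<^esub>}} \<rparr>"

definition intersection_complex :: "('a, 'b) monoid_scheme \<Rightarrow> 'a set set set" where
  "intersection_complex G =
     {\<sigma>. \<sigma> \<noteq> {} \<and> finite \<sigma> \<and> \<sigma> \<subseteq> proper_nontrivial_subgroups G \<and> \<Inter>\<sigma> \<noteq> {\<one>\<^bsub>G\<^esub>}}"

lemma finite_proper_nontrivial_subgroups:
  assumes "finite (carrier G)"
  shows "finite (proper_nontrivial_subgroups G)"
proof (rule finite_subset)
  show "proper_nontrivial_subgroups G \<subseteq> Pow (carrier G)"
    by (auto simp: proper_nontrivial_subgroups_def dest: subgroup.mem_carrier)
qed (use assms in simp)

lemma pair_graph_intersection_graph:
  assumes "finite (carrier G)"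
  shows "pair_graph (intersection_graph G)"
proof -
  have fin: "finite (proper_nontrivial_subgroups G)"
    using assms by (rule finite_proper_nontrivial_subgroups)
  have "finite (parcs (intersection_graph G))"
    by (rule finite_subset[OF _ finite_cartesian_product[OF fin fin]])
      (auto simp: intersection_graph_def)
  with fin show ?thesis
    by unfold_locales (auto simp: intersection_graph_def symmetric_def sym_def arcs_ends_def arc_to_ends_def Int_commute)
qed

lemma abstract_simplicial_complex_intersection_complex:
  "abstract_simplicial_complex (intersection_complex G)"
proof -
  have "\<Inter>\<tau> \<noteq> {\<one>\<^bsub>G\<^esub>}"
    if \<sigma>: "\<sigma> \<subseteq> proper_nontrivial_subgroups G" "\<Inter>\<sigma> \<noteq> {\<one>\<^bsub>G\<^esub>}" and \<tau>: "\<tau> \<subseteq> \<sigma>" for \<sigma> \<tau>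
  proof
    assume "\<Inter>\<tau> = {\<one>\<^bsub>G\<^esub>}"
    moreover have "\<one>\<^bsub>G\<^esub> \<in> \<Inter>\<sigma>"
      using \<sigma>(1) by (auto simp: proper_nontrivial_subgroups_def dest: subgroup.one_closed)
    ultimately show False
      using \<sigma>(2) \<tau> by blast
  qed
  note Int_mono = this
  show ?thesis
    unfolding abstract_simplicial_complex_def
  proof (intro conjI ballI allI impI)
    fix \<sigma> \<tau>
    assume \<sigma>: "\<sigma> \<in> intersection_complex G" and \<tau>: "\<tau> \<subseteq> \<sigma> \<and> \<tau> \<noteq> {}"
    have "finite \<tau>"
      using \<sigma> \<tau> finite_subset unfolding intersection_complex_def by blast
    moreover have "\<Inter>\<tau> \<noteq> {\<one>\<^bsub>G\<^esub>}"
      by (rule Int_mono[of \<sigma>]) (use \<sigma> \<tau> in \<open>simp_all add: intersection_complex_def\<close>)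
    ultimately show "\<tau> \<in> intersection_complex G"
      using \<sigma> \<tau> unfolding intersection_complex_def by blast
  qed (simp_all add: intersection_complex_def)
qed

end

theory Submission
  imports Defs
begin

text \<open>
  The domination number is 1 exactly if some proper non-trivial subgroup \<open>H\<close> meets every proper
  non-trivial subgroup non-trivially.  The intersection \<open>\<Inter>\<sigma>\<close> of the members of a face \<open>\<sigma>\<close> is itself
  a proper non-trivial subgroup, so \<open>H\<close> meets it non-trivially, and adding \<open>H\<close> to \<open>\<sigma>\<close> gives a face
  again.  Hence the intersection complex is a cone with apex \<open>H\<close>
  (\<open>insert_dominating_subgroup_face\<close>), and its realization contracts to the vertex \<open>H\<close> along straight
  line segments (\<open>contractible_geometric_realization_cone\<close>).

  The contraction is visibly continuous for the product topology on barycentric coordinates.  Since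
  \<open>G\<close> is finite, the complex has finitely many faces, and then the weak topology coincides with the
  topology induced from that product (\<open>geometric_realization_finite\<close>).
\<close>

lemma closed_closed_simplex: "closed (closed_simplex \<sigma>)"
  unfolding closed_simplex_def Ball_def
  by (intro closed_Collect_conj closed_Collect_all closed_Collect_imp
      closed_Collect_le closed_Collect_eq open_Collect_const continuous_intros
      continuous_on_product_coordinates)

text \<open>
  The point is that weakly open sets are open.  The complement of a weakly open set meets every closed
  simplex in a closed set, so it is a finite union of closed sets.
\<close>

lemma geometric_realization_finite:
  assumes "finite K"
  shows "geometric_realization K = top_of_set (polyhedron_of K)"
proof -
  have "openin (geometric_realization K) U \<longleftrightarrow> openin (top_of_set (polyhedron_of K)) U" for U
  proof
    assume "openin (geometric_realization K) U"
    then have U: "U \<subseteq> polyhedron_of K"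
      and loc: "\<And>\<sigma>. \<sigma> \<in> K \<Longrightarrow> openin (top_of_set (closed_simplex \<sigma>)) (U \<inter> closed_simplex \<sigma>)"
      unfolding openin_geometric_realization by blast+
    have "closed (closed_simplex \<sigma> - U)" if "\<sigma> \<in> K" for \<sigma>
    proof -
      have "closedin (top_of_set (closed_simplex \<sigma>)) (closed_simplex \<sigma> - U \<inter> closed_simplex \<sigma>)"
        using loc[OF that] by (simp add: openin_closedin_eq)
      moreover have "closed_simplex \<sigma> - U \<inter> closed_simplex \<sigma> = closed_simplex \<sigma> - U"
        by blast
      ultimately show ?thesis
        using closed_closed_simplex by (auto intro: closedin_closed_trans)
    qed
    then have "closed (\<Union>\<sigma>\<in>K. closed_simplex \<sigma> - U)"
      using assms by (intro closed_UN) auto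
    then have "open (- (\<Union>\<sigma>\<in>K. closed_simplex \<sigma> - U))"
      by (rule open_Compl)
    moreover have "U = polyhedron_of K \<inter> - (\<Union>\<sigma>\<in>K. closed_simplex \<sigma> - U)"
      using U unfolding polyhedron_of_def by blast
    ultimately show "openin (top_of_set (polyhedron_of K)) U"
      unfolding openin_open by blast
  next
    assume "openin (top_of_set (polyhedron_of K)) U"
    then obtain T where "open T" and U: "U = polyhedron_of K \<inter> T"
      unfolding openin_open by blast
    have "U \<inter> closed_simplex \<sigma> = closed_simplex \<sigma> \<inter> T" if "\<sigma> \<in> K" for \<sigma>
      using that unfolding U polyhedron_of_def by blast
    with \<open>open T\<close> U show "openin (geometric_realization K) U"
      unfolding openin_geometric_realization by (auto simp: openin_open_Int)
  qed
  then show ?thesis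
    by (simp add: topology_eq)
qed

lemma segment_to_vertex_in_closed_simplex:
  fixes t :: real
  assumes "finite \<sigma>" "x \<in> closed_simplex \<sigma>" "0 \<le> t" "t \<le> 1"
  shows "(\<lambda>v. (1 - t) * x v + t * (if v = a then 1 else 0)) \<in> closed_simplex (insert a \<sigma>)"
proof -
  have x: "\<And>v. v \<in> \<sigma> \<Longrightarrow> 0 \<le> x v" "\<And>v. v \<notin> \<sigma> \<Longrightarrow> x v = 0" "sum x \<sigma> = 1"
    using assms(2) unfolding closed_simplex_def by auto
  have "0 \<le> x v" for v
    using x(1,2) by (cases "v \<in> \<sigma>") auto
  moreover have "sum x (insert a \<sigma>) = 1"
    using assms(1) x by (cases "a \<in> \<sigma>") (auto simp: insert_absorb)
  ultimately show ?thesis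
    using assms x(2)
    by (auto simp: closed_simplex_def sum.distrib simp flip: sum_distrib_left)
qed

text \<open>
  The segment from a point of a face \<open>\<sigma>\<close> to the apex \<open>a\<close> stays in the face \<open>insert a \<sigma>\<close>, so moving every
  point along its segment at constant speed is a homotopy inside the polyhedron.
\<close>

lemma contractible_geometric_realization_cone:
  assumes "finite K" and cone: "\<And>\<sigma>. \<sigma> \<in> K \<Longrightarrow> insert a \<sigma> \<in> K"
    and fin: "\<And>\<sigma>. \<sigma> \<in> K \<Longrightarrow> finite \<sigma>"
  shows "contractible_space (geometric_realization K)"
proof -
  define P where "P = polyhedron_of K"
  define \<delta> :: "'a \<Rightarrow> real" where "\<delta> = (\<lambda>v. if v = a then 1 else 0)"
  define h where "h = (\<lambda>(t :: real, x) v. (1 - t) * x v + t * \<delta> v)"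
  have "continuous_on ({0..1} \<times> P) (\<lambda>z. h z v)" for v
    unfolding h_def case_prod_unfold
    by (intro continuous_intros continuous_on_product_then_coordinatewise[OF continuous_on_snd])
  then have "continuous_on ({0..1} \<times> P) h"
    by (rule continuous_on_coordinatewise_then_product)
  moreover have "h z \<in> P" if z_in: "z \<in> {0..1} \<times> P" for z
  proof -
    obtain t x where z: "z = (t, x)" and t: "0 \<le> t" "t \<le> 1" and "x \<in> P"
      using z_in by (cases z) auto
    then obtain \<sigma> where "\<sigma> \<in> K" "x \<in> closed_simplex \<sigma>"
      unfolding P_def polyhedron_of_def by blast
    then have "h z \<in> closed_simplex (insert a \<sigma>)"
      using segment_to_vertex_in_closed_simplex[of \<sigma> x t a] fin t by (simp add: z h_def \<delta>_def)
    moreover have "insert a \<sigma> \<in> K"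
      using \<open>\<sigma> \<in> K\<close> by (rule cone)
    ultimately show ?thesis
      unfolding P_def polyhedron_of_def by blast
  qed
  ultimately have "continuous_map
      (prod_topology (top_of_set {0..1}) (top_of_set P)) (top_of_set P) h"
    by (auto simp: subtopology_Times[symmetric] euclidean_product_topology)
  then have "homotopic_with (\<lambda>_. True) (top_of_set P) (top_of_set P) id (\<lambda>_. \<delta>)"
    unfolding homotopic_with_def by (intro exI[of _ h]) (auto simp: h_def)
  then show ?thesis
    unfolding contractible_space_def P_def geometric_realization_finite[OF \<open>finite K\<close>] by blast
qed

lemma domination_number_eq_1_dominating_vertex:
  assumes "domination_number \<Gamma> = 1"
  obtains d where "dominating_set \<Gamma> {d}"
proof -
  have ne: "pverts \<Gamma> \<noteq> {}"
    using assms by (auto simp: domination_number_def)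
  let ?size = "\<lambda>D :: 'a set. if finite D then enat (card D) else \<infinity>"
  have "dominating_set \<Gamma> (pverts \<Gamma>)"
    by (simp add: dominating_set_def)
  \<comment> \<open>A non-empty set of extended naturals contains its infimum.\<close>
  then have "Inf (?size ` {D. dominating_set \<Gamma> D}) \<in> ?size ` {D. dominating_set \<Gamma> D}"
    by (intro wellorder_InfI[of "?size (pverts \<Gamma>)"] imageI CollectI)
  then have "1 \<in> ?size ` {D. dominating_set \<Gamma> D}"
    using assms ne by (simp add: domination_number_def)
  then obtain D where "dominating_set \<Gamma> D" "card D = 1"
    by (auto simp: one_enat_def split: if_splits)
  then show thesis
    using that by (auto simp: card_1_singleton_iff)
qed

lemma dominating_subgroup_Int_nontrivial:
  assumes "dominating_set (intersection_graph G) {H}" and "K \<in> proper_nontrivial_subgroups G"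
  shows "H \<inter> K \<noteq> {\<one>\<^bsub>G\<^esub>}"
proof (cases "K = H")
  case True
  then show ?thesis
    using assms(2) by (simp add: proper_nontrivial_subgroups_def)
next
  case False
  then have "(K, H) \<in> parcs (intersection_graph G)"
    using assms by (simp add: dominating_set_def intersection_graph_def)
  then show ?thesis
    by (simp add: intersection_graph_def Int_commute)
qed

lemma (in group) Inter_face_proper_nontrivial:
  assumes "\<sigma> \<in> intersection_complex G"
  shows "\<Inter>\<sigma> \<in> proper_nontrivial_subgroups G"
proof -
  have \<sigma>: "\<sigma> \<noteq> {}" "\<Inter>\<sigma> \<noteq> {\<one>}"
      "\<And>K. K \<in> \<sigma> \<Longrightarrow> subgroup K G \<and> K \<noteq> carrier G"
    using assms by (auto simp: intersection_complex_def proper_nontrivial_subgroups_def)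
  then obtain K where "K \<in> \<sigma>"
    by blast
  then have "\<Inter>\<sigma> \<noteq> carrier G"
    using \<sigma>(3) subgroup.subset by blast
  then show ?thesis
    using \<sigma> subgroups_Inter[of \<sigma>] by (simp add: proper_nontrivial_subgroups_def)
qed

lemma (in group) insert_dominating_subgroup_face:
  assumes dom: "dominating_set (intersection_graph G) {H}" and \<sigma>: "\<sigma> \<in> intersection_complex G"
  shows "insert H \<sigma> \<in> intersection_complex G"
proof -
  have "H \<in> proper_nontrivial_subgroups G"
    using dom by (simp add: dominating_set_def intersection_graph_def)
  moreover have "H \<inter> \<Inter>\<sigma> \<noteq> {\<one>}"
    using dom \<sigma> by (intro dominating_subgroup_Int_nontrivial Inter_face_proper_nontrivial)
  ultimately show ?thesis
    using \<sigma> by (simp add: intersection_complex_def)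
qed

theorem corollary7p4:
  fixes G :: "('a, 'b) monoid_scheme"
  assumes "group G" and "finite (carrier G)"
    and "domination_number (intersection_graph G) = 1"
  shows "contractible_space (geometric_realization (intersection_complex G))"
proof -
  interpret group G by fact
  obtain H where H: "dominating_set (intersection_graph G) {H}"
    using assms(3) by (rule domination_number_eq_1_dominating_vertex)
  have "intersection_complex G \<subseteq> Pow (proper_nontrivial_subgroups G)"
    by (auto simp: intersection_complex_def)
  then have "finite (intersection_complex G)"
    using finite_proper_nontrivial_subgroups[OF assms(2)] by (simp add: finite_subset)
  then show ?thesis
    using insert_dominating_subgroup_face[OF H]
    by (rule contractible_geometric_realization_cone) (auto simp: intersection_complex_def)
qed

end
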